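(* Let $G$ be an isolate-free graph with maximum degree $\Delta(G)$ even and $\Delta(G)\ge 6$, such that $TC(G)=\frac{\Delta(G)^2}{4}+\Delta(G)+1$. Then the total coalition graph of a total coalition partition of $G$ of maximum cardinality is determined up to isomorphism and does not depend on the realising total coalition partition; that is, for any two total coalition partitions $\Psi,\Psi'$ of $G$ with $TC(G)$ classes each, the graphs $TCG(G,\Psi)$ and $TCG(G,\Psi')$ are isomorphic.
   Context: All graphs are finite and simple (no loops or multiple edges). A graph is isolate-free if it has no vertex of degree $0$. A set $T\subseteq V$ of vertices of a graph $G(V,E)$ is a total dominating set if every vertex of $V$ is adjacent to at least one vertex of $T$. Two disjoint sets $A,B\subset V$ form a total coalition if neither $A$ nor $B$ is a total dominating set, but $A\cup B$ is. A total coalition partition of $G$ is a partition $\Psi=\{C_1,\dots,C_k\}$ of $V$ into non-empty classes such that for every $i$ there exists $j\neq i$ such that $C_i$ and $C_j$ form a total coalition. The total coalition number $TC(G)$ of an isolate-free graph $G$ is the maximum cardinality (number of classes) of a total coalition partition of $G$. For a total coalition partition $\Psi$ of $G$, the total coalition graph $TCG(G,\Psi)$ has the classes of $\Psi$ as vertices, two classes being adjacent if and only if they form a total coalition. *)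

theory Defs
  imports Complex_Main "HOL-Library.Disjoint_Sets" "Graph_Theory.Graph_Theory"
begin

text \<open>
  Finite simple graphs are the finite loop-free symmetric pair digraphs of the locale
  \<^locale>\<open>pair_graph\<close>: an edge \<open>uv\<close> is represented by the two arcs \<open>(u, v)\<close> and \<open>(v, u)\<close>,
  so the degree of a vertex is its out-degree.
\<close>

abbreviation degree_in :: "'a pair_pre_digraph \<Rightarrow> 'a \<Rightarrow> nat" where
  "degree_in G v \<equiv> out_degree (with_proj G) v"

lemma (in pair_graph) degree_in_eq_card_neighbours:
  "degree_in G v = card {u. (v, u) \<in> parcs G}"
proof -
  have "out_arcs (with_proj G) v = Pair v ` {u. (v, u) \<in> parcs G}"
    by (auto simp: out_arcs_def)
  then show ?thesis
    by (simp add: out_degree_def card_image inj_on_def)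
qed

definition isolate_free :: "'a pair_pre_digraph \<Rightarrow> bool" where
  "isolate_free G \<longleftrightarrow> (\<forall>v \<in> pverts G. degree_in G v \<noteq> 0)"

text \<open>Only meaningful if the graph has a vertex.\<close>
definition max_degree :: "'a pair_pre_digraph \<Rightarrow> nat" where
  "max_degree G = Max (degree_in G ` pverts G)"

definition total_dominating :: "'a pair_pre_digraph \<Rightarrow> 'a set \<Rightarrow> bool" where
  "total_dominating G T \<longleftrightarrow>
     T \<subseteq> pverts G \<and> (\<forall>v \<in> pverts G. \<exists>u \<in> T. (v, u) \<in> parcs G)"

definition total_coalition :: "'a pair_pre_digraph \<Rightarrow> 'a set \<Rightarrow> 'a set \<Rightarrow> bool" where
  "total_coalition G A B \<longleftrightarrow>
     A \<subseteq> pverts G \<and> B \<subseteq> pverts G \<and> A \<inter> B = {} \<and>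
     \<not> total_dominating G A \<and> \<not> total_dominating G B \<and> total_dominating G (A \<union> B)"

definition total_coalition_partition :: "'a pair_pre_digraph \<Rightarrow> 'a set set \<Rightarrow> bool" where
  "total_coalition_partition G \<Psi> \<longleftrightarrow>
     partition_on (pverts G) \<Psi> \<and> (\<forall>A \<in> \<Psi>. \<exists>B \<in> \<Psi>. B \<noteq> A \<and> total_coalition G A B)"

text \<open>Only meaningful if the graph has a total coalition partition.\<close>
definition TC :: "'a pair_pre_digraph \<Rightarrow> nat" where
  "TC G = Max (card ` {\<Psi>. total_coalition_partition G \<Psi>})"

definition TCG :: "'a pair_pre_digraph \<Rightarrow> 'a set set \<Rightarrow> 'a set pair_pre_digraph" where
  "TCG G \<Psi> = \<lparr> pverts = \<Psi>, parcs = {(A, B). A \<in> \<Psi> \<and> B \<in> \<Psi> \<and> total_coalition G A B} \<rparr>"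

lemma total_coalition_commute: "total_coalition G A B \<longleftrightarrow> total_coalition G B A"
  by (auto simp: total_coalition_def Un_commute)

lemma total_coalition_irrefl: "\<not> total_coalition G A A"
  by (auto simp: total_coalition_def)

lemma (in pair_graph) finite_total_coalition_partitions:
  "finite {\<Psi>. total_coalition_partition G \<Psi>}"
proof (rule finite_subset)
  show "{\<Psi>. total_coalition_partition G \<Psi>} \<subseteq> Pow (Pow (pverts G))"
    by (auto simp: total_coalition_partition_def partition_on_def)
qed (use pair_finite_verts in simp)

lemma (in pair_graph) card_le_TC:
  "total_coalition_partition G \<Psi> \<Longrightarrow> card \<Psi> \<le> TC G"
  unfolding TC_def by (rule Max_ge) (use finite_total_coalition_partitions in auto)

lemma (in pair_graph) pair_graph_TCG:
  assumes "total_coalition_partition G \<Psi>"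
  shows "pair_graph (TCG G \<Psi>)"
proof -
  have fin: "finite \<Psi>"
    using finite_elements[OF pair_finite_verts] assms
    by (simp add: total_coalition_partition_def)
  moreover have "finite {(A, B). A \<in> \<Psi> \<and> B \<in> \<Psi> \<and> total_coalition G A B}"
    by (rule finite_subset[of _ "\<Psi> \<times> \<Psi>"]) (use fin in auto)
  moreover have "total_coalition G A B \<Longrightarrow> total_coalition G B A" for A B
    by (simp add: total_coalition_commute)
  ultimately show ?thesis
    by unfold_locales
      (auto simp: TCG_def symmetric_def total_coalition_irrefl intro!: symI)
qed

text \<open>On pair digraphs, \<^const>\<open>digraph_iso\<close> is the usual isomorphism of graphs.\<close>
lemma (in pair_wf_digraph) digraph_iso_with_proj_iff:
  assumes "pair_wf_digraph H"
  shows "digraph_iso (with_proj G) (with_proj H) \<longleftrightarrow>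
    (\<exists>f. bij_betw f (pverts G) (pverts H) \<and>
      (\<forall>u \<in> pverts G. \<forall>v \<in> pverts G. (u, v) \<in> parcs G \<longleftrightarrow> (f u, f v) \<in> parcs H))"
  (is "?L \<longleftrightarrow> ?R")
proof
  assume ?L
  then obtain h where h: "pre_digraph.digraph_isomorphism (with_proj G) h"
    and H: "with_proj H = app_iso h (with_proj G)"
    unfolding digraph_iso_def by blast
  let ?f = "iso_verts h"
  have V: "pverts H = ?f ` pverts G" and A: "parcs H = iso_arcs h ` parcs G"
    and T: "iso_tail h = fst" and D: "iso_head h = snd"
    using H by (auto simp: with_proj_def app_iso_def)
  have inj: "inj_on ?f (pverts G)"
    using h by (auto simp: pre_digraph.digraph_isomorphism_def)
  have arcs: "iso_arcs h a = (?f (fst a), ?f (snd a))" if "a \<in> parcs G" for a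
    using h that T D by (auto simp: pre_digraph.digraph_isomorphism_def prod_eq_iff)
  have "(u, v) \<in> parcs G \<longleftrightarrow> (?f u, ?f v) \<in> parcs H" if "u \<in> pverts G" "v \<in> pverts G" for u v
  proof
    assume "(u, v) \<in> parcs G"
    then show "(?f u, ?f v) \<in> parcs H" using arcs A by force
  next
    assume "(?f u, ?f v) \<in> parcs H"
    then obtain a where a: "a \<in> parcs G" "(?f u, ?f v) = (?f (fst a), ?f (snd a))"
      using A arcs by auto
    then have "u = fst a" "v = snd a"
      using inj that arc_fst_in_verts arc_snd_in_verts by (auto dest: inj_onD)
    then show "(u, v) \<in> parcs G" using a by simp
  qed
  then show ?R using inj V by (auto simp: bij_betw_def)
next
  assume ?R
  then obtain f where f: "bij_betw f (pverts G) (pverts H)"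
    and adj: "\<And>u v. u \<in> pverts G \<Longrightarrow> v \<in> pverts G \<Longrightarrow> (u, v) \<in> parcs G \<longleftrightarrow> (f u, f v) \<in> parcs H"
    by blast
  interpret H: pair_wf_digraph H by fact
  let ?h = "\<lparr> iso_verts = f, iso_arcs = map_prod f f, iso_head = snd, iso_tail = fst \<rparr>"
  have "parcs H = map_prod f f ` parcs G"
  proof (intro equalityI subsetI)
    fix e assume e: "e \<in> parcs H"
    then have "fst e \<in> f ` pverts G" "snd e \<in> f ` pverts G"
      using f H.arc_fst_in_verts H.arc_snd_in_verts by (auto simp: bij_betw_def)
    then obtain u v where "u \<in> pverts G" "v \<in> pverts G" "e = (f u, f v)"
      by (metis imageE prod.collapse)
    with e show "e \<in> map_prod f f ` parcs G"
      using adj[of u v] by (auto intro: image_eqI[where x = "(u, v)"])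
  next
    fix e assume "e \<in> map_prod f f ` parcs G"
    then obtain u v where uv: "(u, v) \<in> parcs G" "e = (f u, f v)" by auto
    with adj[OF in_arcsD1[OF uv(1)] in_arcsD2[OF uv(1)]] show "e \<in> parcs H" by simp
  qed
  then have "with_proj H = app_iso ?h (with_proj G)"
    using f by (simp add: with_proj_def app_iso_def bij_betw_def)
  moreover have "inj_on (map_prod f f) (parcs G)"
    by (rule inj_on_subset[OF map_prod_inj_on[OF bij_betw_imp_inj_on[OF f] bij_betw_imp_inj_on[OF f]]])
      (use in_arcsD1 in_arcsD2 in auto)
  then have "pre_digraph.digraph_isomorphism (with_proj G) ?h"
    using f wf_digraph_wp_iff pair_wf_digraph_axioms
    by (auto simp: pre_digraph.digraph_isomorphism_def bij_betw_def)
  ultimately show ?L unfolding digraph_iso_def by blast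
qed

end

theory Submission
  imports Defs
begin

text \<open>
  Write \<open>\<Delta> = 2m\<close>. For every vertex \<open>v\<close>, the classes meeting the neighbourhood of \<open>v\<close> form a
  vertex cover of the total coalition graph \<open>H\<close> with at most \<open>2m\<close> elements, every class is missed
  by one of these covers, and two classes are adjacent in \<open>H\<close> iff no cover misses both.
  As \<open>H\<close> has no isolated vertex, it has a spanning forest of \<open>j\<close> non-trivial stars.
  A cover missing the centre of a star with \<open>t\<close> leaves has at least \<open>t + (j - 1)\<close> elements, so
  \<open>H\<close> has at most \<open>j (2m + 2 - j) = (m + 1)\<^sup>2 - (m + 1 - j)\<^sup>2\<close> vertices. Since \<open>H\<close> has
  \<open>(m + 1)\<^sup>2\<close> vertices, there are \<open>m + 1\<close> stars with \<open>m\<close> leaves each. A cover missing a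
  centre then consists of the leaves of its star and all other centres, and this determines all
  edges: \<open>H\<close> is the complete graph \<open>K\<^sub>m\<^sub>+\<^sub>1\<close> on the centres with \<open>m\<close> pendant vertices attached
  to each of them.
\<close>

section \<open>Spanning star forests\<close>

text \<open>The map \<open>f\<close> sends every vertex of a star to its centre.\<close>
definition star_forest :: "('v \<Rightarrow> 'v \<Rightarrow> bool) \<Rightarrow> 'v set \<Rightarrow> ('v \<Rightarrow> 'v) \<Rightarrow> bool" where
  "star_forest adj W f \<longleftrightarrow>
     (\<forall>x\<in>W. f x \<in> W \<and> f (f x) = f x \<and> (f x \<noteq> x \<longrightarrow> adj x (f x)) \<and>
       (f x = x \<longrightarrow> (\<exists>y\<in>W. y \<noteq> x \<and> f y = x)))"

text \<open>\<open>x\<close> always becomes a leaf at \<open>y\<close>; the cases differ in how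
  \<open>y\<close> is made a centre without leaving any star trivial.\<close>

lemma star_forest_extend:
  assumes f: "star_forest adj W f"
    and sym: "\<And>x y. adj x y \<Longrightarrow> adj y x"
    and x: "x \<notin> W" and xy: "adj x y" "x \<noteq> y"
  shows "\<exists>g. star_forest adj (insert x (insert y W)) g"
proof -
  have fW: "\<And>a. a \<in> W \<Longrightarrow> f a \<in> W" and ff: "\<And>a. a \<in> W \<Longrightarrow> f (f a) = f a"
    and f_adj: "\<And>a. a \<in> W \<Longrightarrow> f a \<noteq> a \<Longrightarrow> adj a (f a)"
    and leaf: "\<And>a. a \<in> W \<Longrightarrow> f a = a \<Longrightarrow> \<exists>b\<in>W. b \<noteq> a \<and> f b = a"
    using f unfolding star_forest_def by blast+
  consider "y \<notin> W" | "y \<in> W" "f y = y"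
    | u where "y \<in> W" "f y \<noteq> y" "u \<in> W" "u \<noteq> y" "u \<noteq> f y" "f u = f y"
    | "y \<in> W" "f y \<noteq> y" "\<forall>u\<in>W. f u = f y \<longrightarrow> u = y \<or> u = f y"
    by metis
  then show ?thesis
  proof cases
    case 1
    then have "star_forest adj (insert x (insert y W)) (f(x := y, y := y))"
      using f x xy unfolding star_forest_def by (auto; metis)
    then show ?thesis by blast
  next
    case 2
    then have "star_forest adj (insert x (insert y W)) (f(x := y))"
      using f x xy unfolding star_forest_def by (auto; metis)
    then show ?thesis by blast
  next
    \<comment> \<open>\<open>y\<close> is a leaf whose centre keeps another leaf \<open>u\<close>,
      so \<open>y\<close> may leave its star and start a new one with \<open>x\<close>.\<close>
    case 3
    let ?g = "f(x := y, y := y)"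
    have "f a \<noteq> y \<and> f a \<noteq> x \<and> (f a = a \<longrightarrow> (\<exists>b\<in>W. b \<noteq> a \<and> ?g b = a))"
      if a: "a \<in> W" "a \<noteq> y" for a
    proof (intro conjI impI)
      show "f a \<noteq> y" "f a \<noteq> x" using fW ff a 3 x by metis+
      assume fix_a: "f a = a"
      show "\<exists>b\<in>W. b \<noteq> a \<and> ?g b = a"
      proof (cases "a = f y")
        case True
        then show ?thesis using 3 x by (intro bexI[of _ u]) auto
      next
        case False
        obtain b where "b \<in> W" "b \<noteq> a" "f b = a" using leaf a fix_a by blast
        then show ?thesis using False x by (intro bexI[of _ b]) auto
      qed
    qed
    then have "star_forest adj (insert x (insert y W)) ?g"
      using fW ff f_adj x xy 3 unfolding star_forest_def by auto
    then show ?thesis by blast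
  next
    \<comment> \<open>The star of \<open>y\<close> is a single edge; swapping its ends makes
      \<open>y\<close> the centre, with leaves \<open>x\<close> and \<open>f y\<close>.\<close>
    case 4
    let ?g = "f(x := y, y := y, f y := y)"
    have "f a \<noteq> y \<and> f a \<noteq> x \<and> f a \<noteq> f y \<and> (f a = a \<longrightarrow> (\<exists>b\<in>W. b \<noteq> a \<and> ?g b = a))"
      if a: "a \<in> W" "a \<noteq> y" "a \<noteq> f y" for a
    proof (intro conjI impI)
      show "f a \<noteq> y" "f a \<noteq> x" using fW ff a 4 x by metis+
      show "f a \<noteq> f y" using a 4 by blast
      assume fix_a: "f a = a"
      obtain b where "b \<in> W" "b \<noteq> a" "f b = a" using leaf a fix_a by blast
      moreover from this have "b \<noteq> y" "b \<noteq> f y" "b \<noteq> x" using a ff 4 x by auto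
      ultimately show "\<exists>b\<in>W. b \<noteq> a \<and> ?g b = a" by (intro bexI[of _ b]) auto
    qed
    moreover have "adj (f y) y" "f y \<in> W" "f y \<noteq> x" using fW f_adj sym 4 x by metis+
    ultimately have "star_forest adj (insert x (insert y W)) ?g"
      using fW ff f_adj x xy 4 unfolding star_forest_def by auto
    then show ?thesis by blast
  qed
qed

text \<open>A largest subset of \<open>V\<close> carrying a star forest is all of \<open>V\<close>:
  a missed vertex could be added along an edge to any of its neighbours.\<close>

lemma spanning_star_forest_exists:
  assumes "finite V"
    and sym: "\<And>x y. adj x y \<Longrightarrow> adj y x"
    and nbr: "\<And>x. x \<in> V \<Longrightarrow> \<exists>y\<in>V. y \<noteq> x \<and> adj x y"
  shows "\<exists>f. star_forest adj V f"
proof -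
  let ?P = "\<lambda>W. W \<subseteq> V \<and> (\<exists>f. star_forest adj W f)"
  have "?P {}" by (simp add: star_forest_def)
  then obtain W where W: "?P W" and max: "\<And>W'. ?P W' \<Longrightarrow> card W' \<le> card W"
    using ex_has_greatest_nat[of ?P "{}" card "Suc (card V)"] card_mono[OF \<open>finite V\<close>]
    by (metis le_imp_less_Suc)
  have "W = V"
  proof (rule ccontr)
    assume "W \<noteq> V"
    with W obtain x where x: "x \<in> V" "x \<notin> W" by blast
    then obtain y where y: "y \<in> V" "y \<noteq> x" "adj x y" using nbr by blast
    have "?P (insert x (insert y W))"
      using star_forest_extend[of adj W _ x y] W sym x y by blast
    then have "card (insert x (insert y W)) \<le> card W" by (rule max)
    moreover have "W \<subset> insert x (insert y W)" using x by blast
    ultimately show False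
      using psubset_card_mono[of "insert x (insert y W)" W] W \<open>finite V\<close>
        finite_subset[of W V] by auto
  qed
  with W show ?thesis by blast
qed

section \<open>Graphs given by a family of covers\<close>

text \<open>The vertices \<open>(i, 0)\<close> form a clique, and the pendant vertices at \<open>(i, 0)\<close> are the
  \<open>(i, a)\<close> with \<open>a \<noteq> 0\<close>.\<close>
definition corona_adj :: "nat \<times> nat \<Rightarrow> nat \<times> nat \<Rightarrow> bool" where
  "corona_adj p q \<longleftrightarrow>
     (if fst p = fst q then (snd p = 0) \<noteq> (snd q = 0) else snd p = 0 \<and> snd q = 0)"

text \<open>The equality case of the count, with \<open>Z\<close> the set of centres and
  \<open>t z\<close> the number of leaves at \<open>z\<close>.\<close>

lemma sum_tight:
  fixes t :: "'v \<Rightarrow> nat"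
  assumes "finite Z" and "\<And>z. z \<in> Z \<Longrightarrow> t z + card Z \<le> 2 * m + 1"
    and "(\<Sum>z\<in>Z. Suc (t z)) = (m + 1)\<^sup>2"
  shows "card Z = m + 1" and "\<And>z. z \<in> Z \<Longrightarrow> t z = m"
proof -
  define j where "j = card Z"
  \<comment> \<open>Over \<open>int\<close> the subtraction is exact, so the square can be
    completed.\<close>
  have "int ((m + 1)\<^sup>2) = (\<Sum>z\<in>Z. int (Suc (t z)))"
    using assms(3) by (metis of_nat_sum)
  also have "\<dots> \<le> (\<Sum>z\<in>Z. 2 * int m + 2 - int j)"
    using assms(2) by (intro sum_mono) (force simp: j_def)
  finally have "(int m + 1 - int j)\<^sup>2 \<le> 0"
    by (simp add: j_def power2_eq_square algebra_simps)
  then have "int m + 1 - int j = 0" by simp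
  then show card: "card Z = m + 1" by (simp add: j_def)
  have le: "Suc (t z) \<le> m + 1" if "z \<in> Z" for z
    using assms(2)[OF that] card by simp
  fix z assume z: "z \<in> Z"
  show "t z = m"
  proof (rule ccontr)
    assume "t z \<noteq> m"
    then have "(\<Sum>z\<in>Z. Suc (t z)) < (\<Sum>z\<in>Z. m + 1)"
      using le z \<open>finite Z\<close> by (intro sum_strict_mono_ex1) (auto simp: le_less)
    then show False using assms(3) card by (simp add: power2_eq_square)
  qed
qed

text \<open>The combinatorial core, free of domination: \<open>\<C>\<close> abstracts the family of
  sets of classes met by a neighbourhood. The fixed model on pairs lets two such graphs be
  compared.\<close>

lemma corona_of_small_covers:
  fixes V :: "'v set" and \<C> :: "'v set set"
  assumes fin: "finite V" and card_V: "card V = (m + 1)\<^sup>2" and m: "2 \<le> m"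
    and sub: "\<And>S. S \<in> \<C> \<Longrightarrow> S \<subseteq> V"
    and small: "\<And>S. S \<in> \<C> \<Longrightarrow> card S \<le> 2 * m"
    and avoid: "\<And>x. x \<in> V \<Longrightarrow> \<exists>S\<in>\<C>. x \<notin> S"
    and adj: "\<And>x y. adj x y \<longleftrightarrow> x \<noteq> y \<and> (\<forall>S\<in>\<C>. x \<in> S \<or> y \<in> S)"
    and nbr: "\<And>x. x \<in> V \<Longrightarrow> \<exists>y\<in>V. adj x y"
  shows "\<exists>g. bij_betw g V ({..m} \<times> {..m}) \<and>
    (\<forall>x\<in>V. \<forall>y\<in>V. adj x y \<longleftrightarrow> corona_adj (g x) (g y))"
proof -
  have "\<exists>f. star_forest adj V f"
  proof (rule spanning_star_forest_exists[OF fin])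
    show "adj y x" if "adj x y" for x y
      using that by (auto simp: adj)
    show "\<exists>y\<in>V. y \<noteq> x \<and> adj x y" if "x \<in> V" for x
      using nbr[OF that] by (auto simp: adj)
  qed
  then obtain f where "star_forest adj V f" ..
  then have fV: "\<And>x. x \<in> V \<Longrightarrow> f x \<in> V" and ff: "\<And>x. x \<in> V \<Longrightarrow> f (f x) = f x"
    and f_adj: "\<And>x. x \<in> V \<Longrightarrow> f x \<noteq> x \<Longrightarrow> adj x (f x)"
    and leaf: "\<And>x. x \<in> V \<Longrightarrow> f x = x \<Longrightarrow> \<exists>y\<in>V. y \<noteq> x \<and> f y = x"
    unfolding star_forest_def by auto

  \<comment> \<open>Counting over the stars\<close>
  define Z where "Z = {x\<in>V. f x = x}"
  define L where "L z = {x\<in>V. f x = z \<and> x \<noteq> z}" for z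
  define star where "star z = {x\<in>V. f x = z}" for z
  have ZV: "Z \<subseteq> V" and finZ: "finite Z" and finL: "finite (L z)" for z
    using fin by (auto simp: Z_def L_def)
  have fZ: "f x \<in> Z" if "x \<in> V" for x
    using that fV ff by (simp add: Z_def)
  have fin_star: "finite (star z)" for z using fin by (simp add: star_def)
  have star_eq: "star z = insert z (L z)" and z_notin_L: "z \<notin> L z" if "z \<in> Z" for z
    using that by (auto simp: star_def L_def Z_def)
  have card_fibres: "card S = (\<Sum>z\<in>Z. card (S \<inter> star z))" if "S \<subseteq> V" for S
  proof -
    have "S = (\<Union>z\<in>Z. S \<inter> star z)" using that fZ by (auto simp: star_def)
    then have "card S = card (\<Union>z\<in>Z. S \<inter> star z)" by simp
    also have "\<dots> = (\<Sum>z\<in>Z. card (S \<inter> star z))"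
      using finZ fin_star by (intro card_UN_disjoint) (auto simp: star_def)
    finally show ?thesis .
  qed
  \<comment> \<open>A cover missing a centre must contain the other end of every edge at it, hence
    all its leaves.\<close>
  have L_sub: "L z \<subseteq> S \<inter> star z" if "S \<in> \<C>" "z \<in> Z" "z \<notin> S" for S z
    using that f_adj by (force simp: L_def star_def adj)
  have ge1: "1 \<le> card (S \<inter> star z)" if S: "S \<in> \<C>" and z: "z \<in> Z" for S z
  proof -
    obtain y where y: "y \<in> L z" using leaf[of z] z by (auto simp: Z_def L_def)
    then have "S \<inter> star z \<noteq> {}"
      using L_sub[OF S z] star_eq[OF z] by blast
    then show ?thesis using fin_star by (simp add: Suc_le_eq card_gt_0_iff)
  qed
  \<comment> \<open>A cover avoiding \<open>z\<close> contains all leaves of \<open>z\<close> and at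
    least one vertex of each of the other stars.\<close>
  have bound: "card (L z) + card Z \<le> 2 * m + 1" if z: "z \<in> Z" for z
  proof -
    obtain S where S: "S \<in> \<C>" "z \<notin> S" using avoid z ZV by blast
    have "card (L z) + (card Z - 1) = card (L z) + (\<Sum>w\<in>Z - {z}. 1)"
      using z finZ by (simp add: card_Diff_singleton)
    also have "\<dots> \<le> card (S \<inter> star z) + (\<Sum>w\<in>Z - {z}. card (S \<inter> star w))"
      using ge1[OF S(1)] L_sub[OF S(1) z S(2)] fin_star
      by (intro add_mono sum_mono card_mono) auto
    also have "\<dots> = card S"
      using card_fibres[OF sub[OF S(1)]] sum.remove[OF finZ z] by metis
    also have "\<dots> \<le> 2 * m" by (rule small[OF S(1)])
    finally show ?thesis by simp
  qed
  have "(\<Sum>z\<in>Z. Suc (card (L z))) = (\<Sum>z\<in>Z. card (V \<inter> star z))"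
  proof (rule sum.cong)
    fix z assume "z \<in> Z"
    then show "Suc (card (L z)) = card (V \<inter> star z)"
      using star_eq[of z] z_notin_L[of z] finL ZV
      by (metis (no_types, lifting) Int_absorb1 card_insert_disjoint mem_Collect_eq star_def subsetI)
  qed simp
  then have "(\<Sum>z\<in>Z. Suc (card (L z))) = (m + 1)\<^sup>2"
    using card_fibres[of V] card_V by simp
  from sum_tight[OF finZ bound this]
  have card_Z: "card Z = m + 1" and card_L: "\<And>z. z \<in> Z \<Longrightarrow> card (L z) = m" by auto
  \<comment> \<open>The star of \<open>z\<close> uses up \<open>m\<close> of the at most
    \<open>2 * m\<close> elements of \<open>S\<close>, and the \<open>m - 1\<close> stars other than
    those of \<open>z\<close> and \<open>w\<close> use at least one each. This leaves at most one
    for the star of \<open>w\<close>; missing \<open>w\<close> would cost its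
    \<open>m \<ge> 2\<close> leaves.\<close>
  have single: "S \<inter> star w = {w}" if S: "S \<in> \<C>" "z \<notin> S" and z: "z \<in> Z" and w: "w \<in> Z" "w \<noteq> z"
    for S z w
  proof -
    have "m + (card (S \<inter> star w) + (m - 1))
        = card (L z) + (card (S \<inter> star w) + (\<Sum>u\<in>Z - {z} - {w}. 1))"
      using z w finZ card_L[OF z] card_Z by (simp add: card_Diff_singleton)
    also have "\<dots> \<le> card (S \<inter> star z) +
        (card (S \<inter> star w) + (\<Sum>u\<in>Z - {z} - {w}. card (S \<inter> star u)))"
      using ge1[OF S(1)] L_sub[OF S(1) z S(2)] fin_star
      by (intro add_mono sum_mono card_mono) auto
    also have "\<dots> = card (S \<inter> star z) + (\<Sum>u\<in>Z - {z}. card (S \<inter> star u))"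
      using sum.remove[of "Z - {z}" w "\<lambda>u. card (S \<inter> star u)"] finZ w by simp
    also have "\<dots> = card S"
      using card_fibres[OF sub[OF S(1)]] sum.remove[OF finZ z] by metis
    also have "\<dots> \<le> 2 * m" by (rule small[OF S(1)])
    finally have le: "card (S \<inter> star w) \<le> 1" using m by simp
    have "w \<in> S"
    proof (rule ccontr)
      assume "w \<notin> S"
      then have "m \<le> card (S \<inter> star w)"
        using card_mono[OF _ L_sub[OF S(1) w(1)]] card_L[OF w(1)] fin_star by simp
      with le m show False by simp
    qed
    then have "w \<in> S \<inter> star w" using star_eq[OF w(1)] by blast
    moreover have "finite (S \<inter> star w)" using fin_star by blast
    ultimately show ?thesis
      using le card_le_Suc0_iff_eq[of "S \<inter> star w"] by auto
  qed

  \<comment> \<open>Adjacency read off from the covers\<close>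
  have sep: "\<not> adj x y"
    if "x \<in> V" "y \<in> V" "z \<in> Z" "x \<notin> L z" "y \<notin> L z" "f x \<noteq> x \<or> x = z" "f y \<noteq> y \<or> y = z"
    for x y z
  proof -
    obtain S where S: "S \<in> \<C>" "z \<notin> S" using avoid \<open>z \<in> Z\<close> ZV by blast
    \<comment> \<open>Outside the star of \<open>z\<close>, the cover \<open>S\<close> contains only
      centres. So it misses \<open>z\<close> and all leaves of other stars, and no two vertices it
      misses are adjacent.\<close>
    have *: "u \<notin> S" if u: "u \<in> V" "u \<notin> L z" "f u \<noteq> u \<or> u = z" for u
    proof
      assume "u \<in> S"
      with u S have "u \<noteq> z" "f u \<noteq> z" "u \<noteq> f u" by (auto simp: L_def)
      moreover have "u \<in> S \<inter> star (f u)" using \<open>u \<in> S\<close> u by (simp add: star_def)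
      ultimately show False
        using single[OF S \<open>z \<in> Z\<close> fZ[OF u(1)]] by auto
    qed
    show ?thesis using S(1) *[of x] *[of y] that by (auto simp: adj)
  qed
  \<comment> \<open>There are \<open>m + 1 \<ge> 3\<close> centres. Two leaves are thus both missed
    by a cover that avoids a centre belonging to neither of them.\<close>
  have third: "\<exists>z\<in>Z. z \<noteq> u \<and> z \<noteq> v" for u v
  proof (rule ccontr)
    assume "\<not> ?thesis"
    then have "Z \<subseteq> {u, v}" by blast
    then have "card Z \<le> card {u, v}" by (rule card_mono[rotated]) simp
    also have "\<dots> \<le> 2" by (simp add: card_insert_if)
    finally show False using card_Z m by simp
  qed
  have adj_iff: "adj x y \<longleftrightarrow>
      (if f x = f y then (f x = x) \<noteq> (f y = y) else f x = x \<and> f y = y)"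
    if x: "x \<in> V" and y: "y \<in> V" for x y
  proof -
    have sym: "adj a b \<Longrightarrow> adj b a" for a b by (auto simp: adj)
    have leaf_leaf: "\<not> adj x y" if lf: "f x \<noteq> x" "f y \<noteq> y"
    proof -
      obtain z where "z \<in> Z" "z \<noteq> f x" "z \<noteq> f y" using third by blast
      with lf x y show ?thesis by (intro sep[of x y z]) (auto simp: L_def)
    qed
    \<comment> \<open>A cover that avoids the centre \<open>a\<close> itself also misses the leaf
      \<open>b\<close> of another star.\<close>
    have centre_leaf: "\<not> adj a b" if "a \<in> V" "b \<in> V" "f a = a" "f b \<noteq> b" "f b \<noteq> a" for a b
      using that by (intro sep[of a b a]) (auto simp: L_def Z_def)
    have centres: "adj x y" if c: "f x = x" "f y = y" "x \<noteq> y"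
    proof -
      \<comment> \<open>A cover missing one centre contains all the others.\<close>
      have "y \<in> S" if "S \<in> \<C>" "x \<notin> S" for S
        using single[OF that, of y] c x y by (auto simp: Z_def)
      then show ?thesis using c by (auto simp: adj)
    qed
    show ?thesis
    proof (cases "f x = x"; cases "f y = y")
      assume "f x = x" "f y = y"
      then show ?thesis using centres by (auto simp: adj)
    next
      assume c: "f x = x" "f y \<noteq> y"
      then show ?thesis using centre_leaf[of x y] sym[OF f_adj[OF y]] x y by metis
    next
      assume c: "f x \<noteq> x" "f y = y"
      then show ?thesis using centre_leaf[of y x] sym f_adj[OF x] x y by metis
    next
      assume "f x \<noteq> x" "f y \<noteq> y"
      then show ?thesis using leaf_leaf by metis
    qed
  qed

  \<comment> \<open>Coordinates in the model graph\<close>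
  obtain h where h: "bij_betw h Z {..m}"
    using finite_same_card_bij[OF finZ, of "{..m}"] card_Z by auto
  have "\<exists>p. bij_betw p (L z) {1..m}" if "z \<in> Z" for z
    using finite_same_card_bij[OF finL[of z], of "{1..m}"] card_L[OF that] by auto
  then obtain p where p: "\<And>z. z \<in> Z \<Longrightarrow> bij_betw (p z) (L z) {1..m}" by metis
  \<comment> \<open>The first coordinate numbers the star. Leaves are numbered from 1, so that
    second coordinate 0 marks the centre.\<close>
  define g where "g x = (h (f x), if f x = x then 0 else p (f x) x)" for x
  have p_range: "p (f x) x \<in> {1..m}" if "x \<in> V" "f x \<noteq> x" for x
    using bij_betwE[OF p[OF fZ[OF that(1)]]] that by (auto simp: L_def)
  have fst_g: "fst (g x) = fst (g y) \<longleftrightarrow> f x = f y" if "x \<in> V" "y \<in> V" for x y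
    using inj_on_eq_iff[OF bij_betw_imp_inj_on[OF h]] fZ that by (simp add: g_def)
  have snd0: "snd (g x) = 0 \<longleftrightarrow> f x = x" if "x \<in> V" for x
    using p_range[OF that] by (auto simp: g_def)
  have inj: "inj_on g V"
  proof (rule inj_onI)
    fix x y assume x: "x \<in> V" and y: "y \<in> V" and eq: "g x = g y"
    then have f_eq: "f x = f y" using fst_g[OF x y] by simp
    have iff: "f x = x \<longleftrightarrow> f y = y" using snd0[OF x] snd0[OF y] eq by simp
    show "x = y"
    proof (cases "f x = x")
      case True
      then show ?thesis using iff f_eq by simp
    next
      case False
      then have "x \<in> L (f x)" "y \<in> L (f x)" "p (f x) x = p (f x) y"
        using x y f_eq iff eq by (auto simp: L_def g_def)
      then show ?thesis
        using inj_onD[OF bij_betw_imp_inj_on[OF p[OF fZ[OF x]]]] by blast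
    qed
  qed
  \<comment> \<open>Surjectivity comes from cardinality: \<open>V\<close> and the grid both have
    \<open>(m + 1)\<^sup>2\<close> elements.\<close>
  have "g ` V \<subseteq> {..m} \<times> {..m}"
    using p_range bij_betwE[OF h] fZ by (force simp: g_def)
  moreover have "card (g ` V) = card ({..m} \<times> {..m})"
    using card_image[OF inj] card_V by (simp add: card_cartesian_product power2_eq_square)
  ultimately have "g ` V = {..m} \<times> {..m}" by (intro card_subset_eq) auto
  then have "bij_betw g V ({..m} \<times> {..m})" using inj by (simp add: bij_betw_def)
  moreover have "adj x y \<longleftrightarrow> corona_adj (g x) (g y)" if "x \<in> V" "y \<in> V" for x y
    unfolding corona_adj_def adj_iff[OF that] fst_g[OF that] snd0[OF that(1)] snd0[OF that(2)] ..
  ultimately show ?thesis by blast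
qed

section \<open>Total coalition graphs\<close>

text \<open>The sets \<open>S v\<close> are the covers: a class fails to dominate iff some
  \<open>S v\<close> omits it, and a union of two classes dominates iff every \<open>S v\<close>
  contains one of them.\<close>

lemma (in pair_graph) TCG_corona:
  assumes \<Psi>: "total_coalition_partition G \<Psi>"
    and card: "card \<Psi> = (m + 1)\<^sup>2" and max: "max_degree G = 2 * m" and m: "2 \<le> m"
  shows "\<exists>g. bij_betw g \<Psi> ({..m} \<times> {..m}) \<and>
    (\<forall>A\<in>\<Psi>. \<forall>B\<in>\<Psi>. total_coalition G A B \<longleftrightarrow> corona_adj (g A) (g B))"
proof -
  have part: "partition_on (pverts G) \<Psi>"
    and partner: "\<And>A. A \<in> \<Psi> \<Longrightarrow> \<exists>B\<in>\<Psi>. B \<noteq> A \<and> total_coalition G A B"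
    using \<Psi> by (auto simp: total_coalition_partition_def)
  define S where "S v = {C\<in>\<Psi>. \<exists>u\<in>C. (v, u) \<in> parcs G}" for v
  define adj where "adj A B \<longleftrightarrow> A \<noteq> B \<and> (\<forall>T\<in>S ` pverts G. A \<in> T \<or> B \<in> T)" for A B
  have fin: "finite \<Psi>" using finite_elements[OF pair_finite_verts part] .
  have sub: "A \<subseteq> pverts G" if "A \<in> \<Psi>" for A
    using part that by (auto simp: partition_on_def)
  have disj: "A \<inter> B = {}" if "A \<in> \<Psi>" "B \<in> \<Psi>" "A \<noteq> B" for A B
    using part that by (auto simp: partition_on_def disjoint_def)
  have not_dom: "\<not> total_dominating G A" if "A \<in> \<Psi>" for A
    using partner[OF that] by (auto simp: total_coalition_def)
  \<comment> \<open>Classes are disjoint, and none dominates because each has a coalition partner;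
    only the condition on the union remains.\<close>
  have tc: "total_coalition G A B \<longleftrightarrow> adj A B" if "A \<in> \<Psi>" "B \<in> \<Psi>" for A B
  proof (cases "A = B")
    case True
    then show ?thesis by (simp add: adj_def total_coalition_irrefl)
  next
    case False
    have "total_dominating G (A \<union> B) \<longleftrightarrow> adj A B"
      using False sub that by (auto simp: total_dominating_def adj_def S_def)
    then show ?thesis
      using False sub that not_dom disj by (auto simp: total_coalition_def)
  qed
  have small: "card (S v) \<le> 2 * m" if v: "v \<in> pverts G" for v
  proof -
    have finN: "finite {u. (v, u) \<in> parcs G}"
      by (rule finite_subset[OF _ pair_finite_verts]) (use in_arcsD2 in auto)
    \<comment> \<open>Sending each neighbour of \<open>v\<close> to its class covers
      \<open>S v\<close>, so \<open>S v\<close> has at most as many elements as \<open>v\<close> has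
      neighbours.\<close>
    have "S v \<subseteq> (\<lambda>u. THE C. C \<in> \<Psi> \<and> u \<in> C) ` {u. (v, u) \<in> parcs G}"
    proof
      fix C assume "C \<in> S v"
      then obtain u where u: "C \<in> \<Psi>" "u \<in> C" "(v, u) \<in> parcs G" by (auto simp: S_def)
      then have "(THE C. C \<in> \<Psi> \<and> u \<in> C) = C" using disj by (intro the_equality) blast+
      with u show "C \<in> (\<lambda>u. THE C. C \<in> \<Psi> \<and> u \<in> C) ` {u. (v, u) \<in> parcs G}" by force
    qed
    then have "card (S v) \<le> card {u. (v, u) \<in> parcs G}"
      using finN by (rule surj_card_le[rotated])
    also have "\<dots> \<le> max_degree G"
      unfolding degree_in_eq_card_neighbours[symmetric] max_degree_def
      using v pair_finite_verts by (intro Max_ge) auto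
    finally show ?thesis using max by simp
  qed
  have "\<exists>g. bij_betw g \<Psi> ({..m} \<times> {..m}) \<and>
    (\<forall>A\<in>\<Psi>. \<forall>B\<in>\<Psi>. adj A B \<longleftrightarrow> corona_adj (g A) (g B))"
  proof (rule corona_of_small_covers[OF fin card m, of "S ` pverts G"])
    fix A assume A: "A \<in> \<Psi>"
    then show "\<exists>T\<in>S ` pverts G. A \<notin> T"
      using not_dom[OF A] sub by (auto simp: total_dominating_def S_def)
    show "\<exists>B\<in>\<Psi>. adj A B" using partner[OF A] tc[OF A] by blast
  qed (use small in \<open>auto simp: S_def adj_def\<close>)
  then show ?thesis using tc by simp
qed

theorem theorem5p1:
  fixes G :: "'a pair_pre_digraph" and \<Psi> \<Psi>' :: "'a set set"
  assumes "pair_graph G"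
    and "isolate_free G"
    and "even (max_degree G)" and "max_degree G \<ge> 6"
    and "real (TC G) = real (max_degree G) ^ 2 / 4 + real (max_degree G) + 1"
    and "total_coalition_partition G \<Psi>" and "card \<Psi> = TC G"
    and "total_coalition_partition G \<Psi>'" and "card \<Psi>' = TC G"
  shows "digraph_iso (with_proj (TCG G \<Psi>)) (with_proj (TCG G \<Psi>'))"
proof -
  interpret pair_graph G by fact
  obtain m where D: "max_degree G = 2 * m" using assms(3) by blast
  have m: "2 \<le> m" using assms(4) D by simp
  \<comment> \<open>With maximum degree \<open>2 * m\<close> the assumed value is
    \<open>m\<^sup>2 + 2 * m + 1\<close>.\<close>
  have "real (TC G) = real ((m + 1)\<^sup>2)"
    using assms(5) by (simp add: D power2_eq_square algebra_simps)
  then have TC: "TC G = (m + 1)\<^sup>2" by (simp only: of_nat_eq_iff)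
  obtain g where g: "bij_betw g \<Psi> ({..m} \<times> {..m})"
    and g_adj: "\<forall>A\<in>\<Psi>. \<forall>B\<in>\<Psi>. total_coalition G A B \<longleftrightarrow> corona_adj (g A) (g B)"
    using TCG_corona[OF assms(6) _ D m] assms(7) TC by auto
  obtain g' where g': "bij_betw g' \<Psi>' ({..m} \<times> {..m})"
    and g'_adj: "\<forall>A\<in>\<Psi>'. \<forall>B\<in>\<Psi>'. total_coalition G A B \<longleftrightarrow> corona_adj (g' A) (g' B)"
    using TCG_corona[OF assms(8) _ D m] assms(9) TC by auto
  \<comment> \<open>Both coalition graphs are isomorphic to the same model; the isomorphism passes
    through it.\<close>
  let ?f = "inv_into \<Psi>' g' \<circ> g"
  have f: "bij_betw ?f \<Psi> \<Psi>'"
    using g bij_betw_inv_into[OF g'] by (rule bij_betw_trans)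
  have g'_f: "g' (?f A) = g A" if "A \<in> \<Psi>" for A
    using bij_betw_inv_into_right[OF g'] bij_betwE[OF g] that by simp
  have f_adj: "total_coalition G A B \<longleftrightarrow> total_coalition G (?f A) (?f B)"
    if "A \<in> \<Psi>" "B \<in> \<Psi>" for A B
    using g_adj g'_adj g'_f bij_betwE[OF f] that by metis
  interpret H: pair_graph "TCG G \<Psi>" by (rule pair_graph_TCG) fact
  interpret H': pair_graph "TCG G \<Psi>'" by (rule pair_graph_TCG) fact
  show ?thesis
    unfolding H.digraph_iso_with_proj_iff[OF H'.pair_wf_digraph_axioms]
    using f f_adj bij_betwE[OF f] by (intro exI[of _ ?f]) (simp add: TCG_def)
qed

end
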